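(* Let $p$ be an odd prime, $x\in\mathbb Z_p$ with $x\not\equiv 0,-1\pmod p$, and $x'=(x-\langle x\rangle_p)/p$. Then $$\sum_{n=0}^{p-1}G_n(x)\equiv p^2\frac{x'(x'+1)+1-(-1)^{\langle x\rangle_p}}{x(x+1)}\pmod{p^3}.$$ Consequently, for every prime $p>3$: $$\sum_{n=0}^{p-1}\frac{G_n^{(3)}}{27^n}\equiv\begin{cases}p^2\pmod{p^3}&\text{if }p\equiv1\pmod 3,\\-8p^2\pmod{p^3}&\text{if }p\equiv2\pmod3,\end{cases}\qquad \sum_{n=0}^{p-1}\frac{G_n^{(4)}}{64^n}\equiv\begin{cases}p^2\pmod{p^3}&\text{if }p\equiv1,3\pmod 8,\\-\frac{29}3p^2\pmod{p^3}&\text{if }p\equiv5,7\pmod8,\end{cases}$$ $$\sum_{n=0}^{p-1}\frac{G_n^{(6)}}{432^n}\equiv\begin{cases}p^2\pmod{p^3}&\text{if }p\equiv1\pmod 4,\\-\frac{67}5p^2\pmod{p^3}&\text{if }p\equiv3\pmod4.\end{cases}$$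
   Context: For a real number $x$ and an integer $k\ge0$, $\binom xk=x(x-1)\cdots(x-k+1)/k!$. Define $G_n(x)=\sum_{k=0}^n\binom nk(-1)^k\binom xk\binom{-1-x}k$. For a prime $p$, $\mathbb Z_p$ is the set of rational numbers whose denominator is not divisible by $p$; congruences modulo powers of $p$ are understood in $\mathbb Z_p$. For $x\in\mathbb Z_p$, $\langle x\rangle_p\in\{0,1,\ldots,p-1\}$ is determined by $x\equiv\langle x\rangle_p\pmod p$. Further, $G_n^{(3)}=27^nG_n(-\tfrac13)=\sum_{k=0}^n\binom nk(-1)^k\binom{2k}k\binom{3k}k27^{n-k}$, $G_n^{(4)}=64^nG_n(-\tfrac14)=\sum_{k=0}^n\binom nk(-1)^k\binom{2k}k\binom{4k}{2k}64^{n-k}$, $G_n^{(6)}=432^nG_n(-\tfrac16)=\sum_{k=0}^n\binom nk(-1)^k\binom{3k}k\binom{6k}{3k}432^{n-k}$. *)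

theory Defs
  imports Complex_Main "HOL-Number_Theory.Number_Theory"
begin

text \<open>Here \<open>\<int>\<^sub>p\<close> is the ring of \<open>p\<close>-integral rational numbers (the localisation of the integers
  at \<open>p\<close>), not the ring of \<open>p\<close>-adic integers.\<close>

definition Zp :: "nat \<Rightarrow> rat set" where
  "Zp p = {x. \<not> int p dvd snd (quotient_of x)}"

text \<open>\<open>zp_cong p e a b\<close> is the congruence of \<open>a\<close> and \<open>b\<close> modulo \<open>p ^ e\<close> in \<open>\<int>\<^sub>p\<close>; it includes the
  claim that both sides are elements of \<open>\<int>\<^sub>p\<close>.\<close>

definition zp_cong :: "nat \<Rightarrow> nat \<Rightarrow> rat \<Rightarrow> rat \<Rightarrow> bool" where
  "zp_cong p e a b \<longleftrightarrow> a \<in> Zp p \<and> b \<in> Zp p \<and> (\<exists>c\<in>Zp p. a - b = of_nat (p ^ e) * c)"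

definition zp_residue :: "nat \<Rightarrow> rat \<Rightarrow> nat" where
  "zp_residue p x = (THE r. r < p \<and> zp_cong p 1 x (of_nat r))"

definition G :: "nat \<Rightarrow> rat \<Rightarrow> rat" where
  "G n x = (\<Sum>k=0..n. of_nat (n choose k) * (-1) ^ k * (x gchoose k) * ((-1 - x) gchoose k))"

definition G3 :: "nat \<Rightarrow> rat" where
  "G3 n = 27 ^ n * G n (- 1 / 3)"

definition G4 :: "nat \<Rightarrow> rat" where
  "G4 n = 64 ^ n * G n (- 1 / 4)"

definition G6 :: "nat \<Rightarrow> rat" where
  "G6 n = 432 ^ n * G n (- 1 / 6)"


lemma Zp_iff:
  assumes "prime p"
  shows "x \<in> Zp p \<longleftrightarrow> (\<exists>a b. \<not> int p dvd b \<and> x = of_int a / of_int b)"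
proof
  assume "x \<in> Zp p"
  moreover obtain a b where ab: "quotient_of x = (a, b)" by (cases "quotient_of x")
  ultimately show "\<exists>a b. \<not> int p dvd b \<and> x = of_int a / of_int b"
    using quotient_of_div[OF ab] by (auto simp: Zp_def)
next
  assume "\<exists>a b. \<not> int p dvd b \<and> x = of_int a / of_int b"
  then obtain a b where *: "\<not> int p dvd b" "x = of_int a / of_int b" by blast
  obtain c d where cd: "quotient_of x = (c, d)" by (cases "quotient_of x")
  have d: "d > 0" "coprime c d" using cd quotient_of_denom_pos quotient_of_coprime by blast+
  have "b \<noteq> 0" using *(1) by auto
  then have "(of_int (a * d) :: rat) = of_int (c * b)"
    using *(2) quotient_of_div[OF cd] d(1) by (simp add: field_simps)
  then have "a * d = c * b" by (simp only: of_int_eq_iff)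
  then have "d dvd b" using d(2)
    by (metis coprime_commute coprime_dvd_mult_right_iff dvd_triv_right)
  then show "x \<in> Zp p" using *(1) cd by (auto simp: Zp_def dest: dvd_trans)
qed

lemma zp_residue_unique:
  assumes "prime p" and "x \<in> Zp p"
  shows "\<exists>!r. r < p \<and> zp_cong p 1 x (of_nat r)"
proof -
  have p: "prime (int p)" "p > 0" using assms(1) prime_gt_0_nat by auto
  obtain a b where ab: "\<not> int p dvd b" "x = of_int a / of_int b"
    using assms Zp_iff by blast
  have b0: "b \<noteq> 0" using ab(1) by auto
  have ZpI: "of_nat n \<in> Zp p" for n
  proof -
    have "\<not> int p dvd 1" using p(1) by (simp add: not_prime_1 prime_nat_iff)
    then show ?thesis unfolding Zp_iff[OF assms(1)]
      by (intro exI[of _ "int n"] exI[of _ 1]) simp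
  qed
  have key: "zp_cong p 1 x (of_nat r) \<longleftrightarrow> [a = b * int r] (mod int p)" for r
  proof
    assume "zp_cong p 1 x (of_nat r)"
    then obtain c where "c \<in> Zp p" and c: "x - of_nat r = of_nat p * c"
      by (auto simp: zp_cong_def)
    then obtain u v where uv: "\<not> int p dvd v" "c = of_int u / of_int v"
      using Zp_iff[OF assms(1)] by blast
    have "v \<noteq> 0" using uv(1) by auto
    then have "(of_int ((a - b * int r) * v) :: rat) = of_int (int p * (u * b))"
      using c b0 unfolding ab(2) uv(2) by (simp add: field_simps)
    then have "(a - b * int r) * v = int p * (u * b)" by (simp only: of_int_eq_iff)
    then have "int p dvd (a - b * int r) * v" by simp
    then have "int p dvd a - b * int r" using uv(1) p(1) by (simp add: prime_dvd_mult_iff)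
    then show "[a = b * int r] (mod int p)" by (simp add: cong_iff_dvd_diff)
  next
    assume "[a = b * int r] (mod int p)"
    then obtain u where u: "a - b * int r = int p * u" by (auto simp: cong_iff_dvd_diff)
    then have "(of_int (a - b * int r) :: rat) = of_int (int p * u)" by simp
    then have "x - of_nat r = of_nat (p ^ 1) * (of_int u / of_int b)"
      using b0 unfolding ab(2) by (simp add: field_simps)
    moreover have "of_int u / of_int b \<in> Zp p" using Zp_iff[OF assms(1)] ab(1) by blast
    ultimately show "zp_cong p 1 x (of_nat r)"
      using assms(2) ZpI unfolding zp_cong_def by blast
  qed
  have cop: "coprime b (int p)" using prime_imp_coprime[OF p(1) ab(1)] by (simp add: coprime_commute)
  then obtain c where c: "[b * c = 1] (mod int p)" using cong_solve_coprime_int by blast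
  define r where "r = nat ((a * c) mod int p)"
  have r: "int r = (a * c) mod int p" "r < p" using p(2) by (simp_all add: r_def nat_less_iff)
  have "[b * int r = b * (a * c)] (mod int p)" unfolding r(1) by (simp add: cong_def mod_mult_right_eq)
  also have "b * (a * c) = a * (b * c)" by simp
  also have "[a * (b * c) = a * 1] (mod int p)" using c cong_scalar_left by blast
  finally have "[a = b * int r] (mod int p)" by (simp add: cong_sym)
  moreover have "s = r" if "s < p" "[a = b * int s] (mod int p)" for s
  proof -
    have "[b * int s = b * int r] (mod int p)" using that(2) calculation cong_sym cong_trans by blast
    then have "[int s = int r] (mod int p)" using cop cong_mult_lcancel by blast
    then show ?thesis using that(1) r(2) by (simp add: cong_int_iff cong_less_modulus_unique_nat)
  qed
  ultimately show ?thesis using r(2) key by blast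
qed

lemma gchoose_Suc_div: "x gchoose Suc k = (x gchoose k) * (x - of_nat k) / (of_nat k + 1)"
  for x :: rat
  by (simp add: gbinomial_prod_rev field_simps)

lemma gchoose_thirds:
  "((- 1 / 3) gchoose k) * ((-1 - (- 1 / 3)) gchoose k) * 27 ^ k =
    (of_nat ((2 * k) choose k) * of_nat ((3 * k) choose k) :: rat)"
proof -
  have "((- 1 / 3) gchoose k) * ((- 2 / 3) gchoose k) * 27 ^ k = (fact (3 * k) / fact k ^ 3 :: rat)"
  proof (induction k)
    case (Suc k)
    have f: "(fact (3 * Suc k) :: rat) =
        (3 * of_nat k + 3) * (3 * of_nat k + 2) * (3 * of_nat k + 1) * fact (3 * k)"
      by (simp add: eval_nat_numeral algebra_simps)
    have "((- 1 / 3) gchoose Suc k) * ((- 2 / 3) gchoose Suc k) * 27 ^ Suc k =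
        (((- 1 / 3) gchoose k) * ((- 2 / 3) gchoose k) * 27 ^ k) *
        (27 * (- 1 / 3 - of_nat k) * (- 2 / 3 - of_nat k) / (of_nat k + 1) ^ 2 :: rat)"
      by (simp add: gchoose_Suc_div power2_eq_square)
    also have "\<dots> = fact (3 * Suc k) / fact (Suc k) ^ 3"
      unfolding Suc.IH f by (simp add: divide_simps power_mult_distrib add_eq_0_iff_both_eq_0)
        (simp add: algebra_simps power2_eq_square power3_eq_cube)
    finally show ?case .
  qed simp
  also have "\<dots> = of_nat ((2 * k) choose k) * of_nat ((3 * k) choose k)"
    by (simp add: binomial_fact power3_eq_cube)
  finally show ?thesis by simp
qed

lemma gchoose_quarters:
  "((- 1 / 4) gchoose k) * ((-1 - (- 1 / 4)) gchoose k) * 64 ^ k =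
    (of_nat ((2 * k) choose k) * of_nat ((4 * k) choose (2 * k)) :: rat)"
proof -
  have "((- 1 / 4) gchoose k) * ((- 3 / 4) gchoose k) * 64 ^ k =
      (fact (4 * k) / (fact (2 * k) * fact k ^ 2) :: rat)"
  proof (induction k)
    case (Suc k)
    define y :: rat where "y = of_nat k"
    have y: "2 * y + 1 \<noteq> 0" "y + 1 \<noteq> 0"
      using of_nat_0_le_iff[of k, where ?'a = rat] by (simp_all flip: y_def)
    have f: "(fact (4 * Suc k) :: rat) =
        8 * ((y + 1) * ((4 * y + 3) * ((2 * y + 1) * (4 * y + 1)))) * fact (4 * k)"
    proof -
      have r: "4 * y + 4 = 4 * (y + 1)" "4 * y + 2 = 2 * (2 * y + 1)" by simp_all
      have "4 * Suc k = Suc (Suc (Suc (Suc (4 * k))))" by simp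
      then have "(fact (4 * Suc k) :: rat) =
          (4 * y + 4) * ((4 * y + 3) * ((4 * y + 2) * ((4 * y + 1) * fact (4 * k))))"
        by (simp only: fact_Suc) (simp add: y_def add.commute)
      also have "\<dots> = (4 * (y + 1)) * ((4 * y + 3) * ((2 * (2 * y + 1)) *
          ((4 * y + 1) * fact (4 * k))))"
        unfolding r ..
      finally show ?thesis by (simp del: distrib_left_numeral)
    qed
    have g: "(fact (2 * Suc k) :: rat) = 2 * ((y + 1) * (2 * y + 1)) * fact (2 * k)"
      by (simp add: y_def eval_nat_numeral algebra_simps)
    have h: "(fact (Suc k) :: rat) = (y + 1) * fact k"
      by (simp add: y_def)
    have "((- 1 / 4) gchoose Suc k) * ((- 3 / 4) gchoose Suc k) * 64 ^ Suc k =
        (((- 1 / 4) gchoose k) * ((- 3 / 4) gchoose k) * 64 ^ k) *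
        (64 * ((- 1 / 4 - y) * (- 3 / 4 - y)) / (y + 1) ^ 2 :: rat)"
      by (simp add: y_def gchoose_Suc_div power2_eq_square)
    also have "64 * ((- 1 / 4 - y) * (- 3 / 4 - y)) = 4 * ((4 * y + 3) * (4 * y + 1))"
      by (simp add: field_simps)
    also note Suc.IH
    also have "(fact (4 * k) / (fact (2 * k) * fact k ^ 2)) *
        (4 * ((4 * y + 3) * (4 * y + 1)) / (y + 1) ^ 2) =
        fact (4 * Suc k) / (fact (2 * Suc k) * fact (Suc k) ^ 2)"
      unfolding f g h using y by (simp add: power2_eq_square) (simp add: ac_simps)
    finally show ?case .
  qed simp
  also have "\<dots> = of_nat ((2 * k) choose k) * of_nat ((4 * k) choose (2 * k))"
    by (simp add: binomial_fact power2_eq_square)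
  finally show ?thesis by simp
qed

lemma gchoose_sixths:
  "((- 1 / 6) gchoose k) * ((-1 - (- 1 / 6)) gchoose k) * 432 ^ k =
    (of_nat ((3 * k) choose k) * of_nat ((6 * k) choose (3 * k)) :: rat)"
proof -
  have "((- 1 / 6) gchoose k) * ((- 5 / 6) gchoose k) * 432 ^ k =
      (fact (6 * k) / (fact (3 * k) * fact (2 * k) * fact k) :: rat)"
  proof (induction k)
    case (Suc k)
    define y :: rat where "y = of_nat k"
    have y: "2 * y + 1 \<noteq> 0" "y + 1 \<noteq> 0" "3 * y + 1 \<noteq> 0" "3 * y + 2 \<noteq> 0"
      using of_nat_0_le_iff[of k, where ?'a = rat] by (simp_all flip: y_def)
    have f: "(fact (6 * Suc k) :: rat) = 72 * ((y + 1) * ((6 * y + 5) * ((3 * y + 2) *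
        ((2 * y + 1) * ((3 * y + 1) * (6 * y + 1)))))) * fact (6 * k)"
    proof -
      have r: "6 * y + 6 = 6 * (y + 1)" "6 * y + 4 = 2 * (3 * y + 2)"
        "6 * y + 3 = 3 * (2 * y + 1)" "6 * y + 2 = 2 * (3 * y + 1)" by simp_all
      have "6 * Suc k = Suc (Suc (Suc (Suc (Suc (Suc (6 * k))))))" by simp
      then have "(fact (6 * Suc k) :: rat) = (6 * y + 6) * ((6 * y + 5) * ((6 * y + 4) *
          ((6 * y + 3) * ((6 * y + 2) * ((6 * y + 1) * fact (6 * k))))))"
        by (simp only: fact_Suc) (simp add: y_def add.commute)
      also have "\<dots> = (6 * (y + 1)) * ((6 * y + 5) * ((2 * (3 * y + 2)) *
          ((3 * (2 * y + 1)) * ((2 * (3 * y + 1)) * ((6 * y + 1) * fact (6 * k))))))"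
        unfolding r ..
      finally show ?thesis by (simp del: distrib_left_numeral)
    qed
    have g: "(fact (2 * Suc k) :: rat) = 2 * ((y + 1) * (2 * y + 1)) * fact (2 * k)"
      by (simp add: y_def eval_nat_numeral algebra_simps)
    have h: "(fact (3 * Suc k) :: rat) =
        3 * ((y + 1) * ((3 * y + 2) * (3 * y + 1))) * fact (3 * k)"
      by (simp add: y_def eval_nat_numeral algebra_simps)
    have i: "(fact (Suc k) :: rat) = (y + 1) * fact k"
      by (simp add: y_def)
    have "((- 1 / 6) gchoose Suc k) * ((- 5 / 6) gchoose Suc k) * 432 ^ Suc k =
        (((- 1 / 6) gchoose k) * ((- 5 / 6) gchoose k) * 432 ^ k) *
        (432 * ((- 1 / 6 - y) * (- 5 / 6 - y)) / (y + 1) ^ 2 :: rat)"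
      by (simp add: y_def gchoose_Suc_div power2_eq_square)
    also have "432 * ((- 1 / 6 - y) * (- 5 / 6 - y)) = 12 * ((6 * y + 5) * (6 * y + 1))"
      by (simp add: field_simps)
    also note Suc.IH
    also have "(fact (6 * k) / (fact (3 * k) * fact (2 * k) * fact k)) *
        (12 * ((6 * y + 5) * (6 * y + 1)) / (y + 1) ^ 2) =
        fact (6 * Suc k) / (fact (3 * Suc k) * fact (2 * Suc k) * fact (Suc k))"
      unfolding f g h i using y by (simp add: power2_eq_square) (simp add: ac_simps)
    finally show ?case .
  qed simp
  also have "\<dots> = of_nat ((3 * k) choose k) * of_nat ((6 * k) choose (3 * k))"
    by (simp add: binomial_fact)
  finally show ?thesis by simp
qed

lemma G_scaled:
  fixes c :: "nat \<Rightarrow> rat"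
  assumes "\<And>k. (x gchoose k) * ((-1 - x) gchoose k) * m ^ k = c k"
  shows "m ^ n * G n x = (\<Sum>k=0..n. of_nat (n choose k) * (-1) ^ k * c k * m ^ (n - k))"
proof -
  have "m ^ n = m ^ k * m ^ (n - k)" if "k \<le> n" for k
    using that by (simp flip: power_add)
  then show ?thesis
    unfolding G_def sum_distrib_left assms[symmetric] by (intro sum.cong) (auto simp: ac_simps)
qed

lemma G3_eq: "G3 n = (\<Sum>k=0..n. of_nat (n choose k) * (-1) ^ k *
    (of_nat ((2 * k) choose k) * of_nat ((3 * k) choose k)) * 27 ^ (n - k))"
  unfolding G3_def by (rule G_scaled[OF gchoose_thirds])

lemma G4_eq: "G4 n = (\<Sum>k=0..n. of_nat (n choose k) * (-1) ^ k *
    (of_nat ((2 * k) choose k) * of_nat ((4 * k) choose (2 * k))) * 64 ^ (n - k))"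
  unfolding G4_def by (rule G_scaled[OF gchoose_quarters])

lemma G6_eq: "G6 n = (\<Sum>k=0..n. of_nat (n choose k) * (-1) ^ k *
    (of_nat ((3 * k) choose k) * of_nat ((6 * k) choose (3 * k))) * 432 ^ (n - k))"
  unfolding G6_def by (rule G_scaled[OF gchoose_sixths])

end

theory Submission
  imports Defs "HOL-Computational_Algebra.Formal_Power_Series"
begin

text \<open>Put \<open>a\<^sub>k = binom(x, k) binom(-1 - x, k)\<close> and \<open>b\<^sub>k = (-1)^k binom(p - 1, k)\<close>. Summation by parts
  gives the exact identity \<open>x (x + 1) (\<Sum>n<p. G n x) = - p\<^sup>2 (\<Sum>k=1..p. a\<^sub>k b\<^bsub>k - 1\<^esub>)\<close>, so only the
  last sum modulo \<open>p\<close> is needed. There \<open>b\<^sub>k \<equiv> 1\<close>; for \<open>k < p\<close> the number \<open>x = r + p t\<close> may be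
  replaced by its residue \<open>r\<close>, and Vandermonde's identity gives \<open>(\<Sum>k<p. a\<^sub>k) \<equiv> (-1)^r\<close>; finally
  \<open>a\<^sub>p \<equiv> - t (t + 1)\<close>.\<close>

section \<open>The local ring \<open>Zp p\<close> and its units\<close>

lemma Zp_of_int: "of_int n \<in> Zp p" if "prime p"
  unfolding Zp_iff[OF that] using that
  by (intro exI[of _ n] exI[of _ 1]) (auto simp: not_prime_1 prime_nat_iff)

lemma Zp_of_nat: "of_nat n \<in> Zp p" if "prime p"
  using Zp_of_int[OF that, of "int n"] by simp

lemma Zp_0: "0 \<in> Zp p" and Zp_1: "1 \<in> Zp p" if "prime p"
  using Zp_of_nat[OF that, of 0] Zp_of_nat[OF that, of 1] by simp_all

lemma Zp_add: "x + y \<in> Zp p" and Zp_mult: "x * y \<in> Zp p"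
  if p: "prime p" and xy: "x \<in> Zp p" "y \<in> Zp p"
proof -
  obtain a b c d where ab: "\<not> int p dvd b" "x = of_int a / of_int b"
    and cd: "\<not> int p dvd d" "y = of_int c / of_int d"
    using xy unfolding Zp_iff[OF p] by blast
  have "b \<noteq> 0" "d \<noteq> 0" using ab cd by auto
  then have "x + y = of_int (a * d + c * b) / of_int (b * d)" "x * y = of_int (a * c) / of_int (b * d)"
    using ab cd by (simp_all add: field_simps)
  moreover have "\<not> int p dvd b * d"
    using ab cd p by (simp add: prime_dvd_mult_iff)
  ultimately show "x + y \<in> Zp p" "x * y \<in> Zp p"
    unfolding Zp_iff[OF p] by blast+
qed

lemma Zp_uminus: "- x \<in> Zp p" if "prime p" "x \<in> Zp p"
  using Zp_mult[OF that(1) Zp_of_int[OF that(1), of "-1"] that(2)] by simp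

lemma Zp_diff: "x - y \<in> Zp p" if "prime p" "x \<in> Zp p" "y \<in> Zp p"
  using Zp_add[OF that(1,2) Zp_uminus[OF that(1,3)]] by simp

text \<open>A numerator divisible by \<open>p\<close> would make \<open>x\<close> congruent to 0, so
  numerator and denominator may be exchanged.\<close>

lemma Zp_inverse: "inverse x \<in> Zp p"
  if p: "prime p" and x: "x \<in> Zp p" "\<not> zp_cong p 1 x 0"
proof -
  obtain a b where ab: "\<not> int p dvd b" "x = of_int a / of_int b"
    using x unfolding Zp_iff[OF p] by blast
  have "\<not> int p dvd a"
  proof
    assume "int p dvd a"
    then obtain c where "a = int p * c" by blast
    then have "x - 0 = of_nat (p ^ 1) * (of_int c / of_int b)"
      using ab by simp
    moreover have "of_int c / of_int b \<in> Zp p"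
      using ab unfolding Zp_iff[OF p] by blast
    ultimately show False
      using x Zp_0[OF p] unfolding zp_cong_def by blast
  qed
  moreover have "inverse x = of_int b / of_int a"
    using ab by simp
  ultimately show ?thesis
    unfolding Zp_iff[OF p] by blast
qed

lemma Zp_inverse_of_nat: "inverse (of_nat n) \<in> Zp p" if "prime p" "\<not> p dvd n"
  unfolding Zp_iff[OF that(1)]
  using that by (intro exI[of _ 1] exI[of _ "int n"]) (auto simp: inverse_eq_divide)

section \<open>Congruence arithmetic in \<open>Zp p\<close>\<close>

lemma zp_cong_refl: "zp_cong p e a a" if "prime p" "a \<in> Zp p"
  using that Zp_0[of p] unfolding zp_cong_def by auto

lemma zp_cong_trans: "zp_cong p e a c"
  if p: "prime p" and cong: "zp_cong p e a b" "zp_cong p e b c"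
proof -
  obtain u v where "u \<in> Zp p" "v \<in> Zp p" "a - b = of_nat (p ^ e) * u" "b - c = of_nat (p ^ e) * v"
    using cong unfolding zp_cong_def by blast
  then have "a - c = of_nat (p ^ e) * (u + v)" "u + v \<in> Zp p"
    using Zp_add[OF p] by (simp_all add: algebra_simps)
  then show ?thesis using cong unfolding zp_cong_def by blast
qed

lemma zp_cong_add: "zp_cong p e (a + c) (b + d)"
  if p: "prime p" and cong: "zp_cong p e a b" "zp_cong p e c d"
proof -
  obtain u v where "u \<in> Zp p" "v \<in> Zp p" "a - b = of_nat (p ^ e) * u" "c - d = of_nat (p ^ e) * v"
    using cong unfolding zp_cong_def by blast
  then have "(a + c) - (b + d) = of_nat (p ^ e) * (u + v)" "u + v \<in> Zp p"
    using Zp_add[OF p] by (simp_all add: algebra_simps)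
  then show ?thesis using that Zp_add[OF p] unfolding zp_cong_def by blast
qed

lemma zp_cong_mult: "zp_cong p e (a * c) (b * d)"
  if p: "prime p" and cong: "zp_cong p e a b" "zp_cong p e c d"
proof -
  obtain u v where uv: "u \<in> Zp p" "v \<in> Zp p" "a - b = of_nat (p ^ e) * u" "c - d = of_nat (p ^ e) * v"
    using cong unfolding zp_cong_def by blast
  have "a * c - b * d = (a - b) * c + b * (c - d)" by (simp add: algebra_simps)
  also have "\<dots> = of_nat (p ^ e) * (u * c + b * v)"
    unfolding uv by (simp add: algebra_simps)
  finally have "a * c - b * d = of_nat (p ^ e) * (u * c + b * v)" .
  moreover have "u * c + b * v \<in> Zp p"
    using uv that unfolding zp_cong_def by (intro Zp_add[OF p] Zp_mult[OF p]) auto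
  ultimately show ?thesis using that Zp_mult[OF p] unfolding zp_cong_def by blast
qed

lemma zp_cong_cmult: "zp_cong p e (c * a) (c * b)"
  if "prime p" "c \<in> Zp p" "zp_cong p e a b"
  using zp_cong_mult[OF that(1) zp_cong_refl[OF that(1,2)] that(3)] .

lemma zp_cong_uminus: "zp_cong p e (- a) (- b)" if "prime p" "zp_cong p e a b"
  using zp_cong_cmult[OF that(1) Zp_of_int[OF that(1), of "-1"] that(2)] by simp

lemma zp_cong_diff: "zp_cong p e (a - c) (b - d)"
  if "prime p" "zp_cong p e a b" "zp_cong p e c d"
  using zp_cong_add[OF that(1,2) zp_cong_uminus[OF that(1,3)]] by simp

lemma zp_cong_sum: "zp_cong p e (sum f A) (sum g A)"
  if "prime p" and "\<And>k. k \<in> A \<Longrightarrow> zp_cong p e (f k) (g k)"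
  using that(2)
  by (induction A rule: infinite_finite_induct)
    (auto intro: zp_cong_add[OF that(1)] zp_cong_refl[OF that(1) Zp_0[OF that(1)]])

text \<open>With \<open>d = 2\<close> and \<open>e = 1\<close> this is the passage from the
  congruence modulo \<open>p\<close> of the inner sum to the final one modulo
  \<open>p^3\<close>.\<close>

lemma zp_cong_power_mult: "zp_cong p (d + e) (of_nat p ^ d * a) (of_nat p ^ d * b)"
  if p: "prime p" and ab: "zp_cong p e a b"
proof -
  obtain c where c: "c \<in> Zp p" "a - b = of_nat (p ^ e) * c" using ab unfolding zp_cong_def by blast
  have "of_nat p ^ d * a - of_nat p ^ d * b = of_nat p ^ d * (a - b)"
    by (simp add: algebra_simps)
  also have "\<dots> = of_nat (p ^ (d + e)) * c" by (simp add: c power_add)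
  finally show ?thesis
    using ab c(1) Zp_mult[OF p] Zp_of_nat[OF p, of "p ^ d"] unfolding zp_cong_def by auto
qed

lemma zp_cong_add_multiple: "zp_cong p 1 (a + of_nat p * t) a"
  if p: "prime p" and "a \<in> Zp p" "t \<in> Zp p"
  using that Zp_add[OF p] Zp_mult[OF p] Zp_of_nat[OF p] unfolding zp_cong_def by auto

text \<open>Brings a congruence in \<open>Zp p\<close> back to divisibility in the naturals, where
  size bounds can refute it.\<close>

lemma zp_cong_of_nat_imp_dvd: "p dvd n" if p: "prime p" and n: "zp_cong p 1 (of_nat n) 0"
proof -
  obtain c where "c \<in> Zp p" and c: "of_nat n = of_nat p * c"
    using n unfolding zp_cong_def by auto
  then obtain u v where uv: "\<not> int p dvd v" "c = of_int u / of_int v"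
    using Zp_iff[OF p] by blast
  then have "v \<noteq> 0" by auto
  then have "(of_int (int n * v) :: rat) = of_int (int p * u)"
    using c uv(2) by (simp add: field_simps)
  then have "int n * v = int p * u" by (simp only: of_int_eq_iff)
  then have "int p dvd int n * v" by simp
  then show ?thesis using uv(1) p by (simp add: prime_dvd_mult_iff)
qed

section \<open>Generalized binomial coefficients modulo \<open>p\<close>\<close>

text \<open>For \<open>k < p\<close> the factorial of \<open>k\<close> is a unit, so the binomial
  coefficient is a polynomial in its upper argument with coefficients in \<open>Zp p\<close>. The
  induction divides by one unit \<open>k + 1\<close> at a time.\<close>

lemma zp_cong_gchoose: "zp_cong p 1 (x gchoose k) (y gchoose k)"
  if p: "prime p" and xy: "zp_cong p 1 x y" and "k < p"
  using that(3)
proof (induction k)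
  case 0
  then show ?case by (simp add: zp_cong_refl[OF p Zp_1[OF p]])
next
  case (Suc k)
  have "\<not> p dvd Suc k" using Suc.prems by (auto dest: dvd_imp_le)
  then have "inverse (of_nat k + 1) \<in> Zp p"
    using Zp_inverse_of_nat[OF p] by (metis of_nat_Suc add.commute)
  moreover have "zp_cong p 1 ((x gchoose k) * (x - of_nat k)) ((y gchoose k) * (y - of_nat k))"
    using Suc by (intro zp_cong_mult[OF p] zp_cong_diff[OF p] xy zp_cong_refl[OF p] Zp_of_nat[OF p]) auto
  ultimately show ?case
    using zp_cong_cmult[OF p] unfolding gchoose_Suc_div by (simp add: divide_inverse mult.commute)
qed

text \<open>At lower index \<open>p\<close> the denominator is no longer a unit, and the value
  modulo \<open>p\<close> depends on the quotient \<open>t\<close>. Vandermonde's identity separates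
  \<open>r\<close> from \<open>p t\<close>; only the term with \<open>k = 0\<close> survives modulo
  \<open>p\<close>.\<close>

lemma zp_cong_gchoose_prime: "zp_cong p 1 ((of_nat r + of_nat p * t) gchoose p) t"
  if p: "prime p" and "odd p" and r: "r < p" and t: "t \<in> Zp p"
proof -
  have pt: "zp_cong p 1 (a + of_nat p * t) a" if "a \<in> Zp p" for a
    using zp_cong_add_multiple[OF p that t] .
  have p0: "p > 0" using p prime_gt_0_nat by blast
  have "zp_cong p 1 (\<Sum>k=0..p. (of_nat r gchoose k) * ((of_nat p * t) gchoose (p - k)))
      (\<Sum>k=0..p. if k = 0 then t else 0)"
  proof (intro zp_cong_sum[OF p])
    fix k assume "k \<in> {0..p}"
    consider "k = 0" | "k = p" "p \<noteq> 0" | "0 < k" "k < p"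
      using \<open>k \<in> {0..p}\<close> p0 by fastforce
    then show "zp_cong p 1 ((of_nat r gchoose k) * ((of_nat p * t) gchoose (p - k))) (if k = 0 then t else 0)"
    proof cases
      case 1
      \<comment> \<open>Absorption cancels the factor \<open>p\<close> exactly and lowers the index
        to \<open>p - 1\<close>, where the upper argument may be reduced modulo
        \<open>p\<close>.\<close>
      have "of_nat p * ((of_nat p * t) gchoose p) = (of_nat p * t) * ((of_nat p * t - 1) gchoose (p - 1))"
        using gbinomial_absorption[of "p - 1" "of_nat p * t"] p0 by simp
      then have eq: "(of_nat p * t) gchoose p = t * ((of_nat p * t - 1) gchoose (p - 1))"
        using p0 by simp
      have "zp_cong p 1 ((of_nat p * t - 1) gchoose (p - 1)) ((-1) gchoose (p - 1))"
        using zp_cong_gchoose[OF p pt[of "-1"], of "p - 1"] p0 Zp_of_int[OF p, of "-1"] by simp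
      moreover have "(-1 :: rat) gchoose (p - 1) = 1"
        using gbinomial_minus[of "1::rat" "p - 1"] \<open>odd p\<close>
        by (simp flip: binomial_gbinomial)
      ultimately show ?thesis using 1 zp_cong_cmult[OF p t] eq by fastforce
    next
      case 2
      have "of_nat r gchoose p = (0 :: rat)" using r by (simp flip: binomial_gbinomial)
      then show ?thesis using 2 zp_cong_refl[OF p Zp_0[OF p]] by simp
    next
      case 3
      \<comment> \<open>Here \<open>0 < p - k < p\<close>, so \<open>p t\<close> may be replaced by
        0, and \<open>0 gchoose (p - k)\<close> vanishes.\<close>
      have "zp_cong p 1 ((of_nat p * t) gchoose (p - k)) (0 gchoose (p - k))"
        using zp_cong_gchoose[OF p pt[OF Zp_0[OF p]], of "p - k"] 3 by simp
      then have "zp_cong p 1 ((of_nat p * t) gchoose (p - k)) 0"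
        using 3 by (simp add: gbinomial_0_left)
      then have "zp_cong p 1 (of_nat (r choose k) * ((of_nat p * t) gchoose (p - k)))
          (of_nat (r choose k) * 0)"
        by (intro zp_cong_cmult[OF p] Zp_of_nat[OF p])
      then show ?thesis using 3 by (simp add: binomial_gbinomial)
    qed
  qed
  then show ?thesis
    using gbinomial_Vandermonde[of "of_nat r :: rat" "of_nat p * t" p] by simp
qed

section \<open>Exact summation identities\<close>

text \<open>Terms with \<open>k > r\<close> vanish. Reflecting \<open>k\<close> to
  \<open>r - k\<close> in the first factor makes the rest a Vandermonde convolution with upper
  arguments adding up to -1.\<close>

lemma sum_gchoose_mult_gchoose:
  "(\<Sum>k=0..n. (of_nat r gchoose k) * ((-1 - of_nat r) gchoose k)) = (-1 :: rat) ^ r" if "r \<le> n"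
proof -
  have "(\<Sum>k=0..n. (of_nat r gchoose k) * ((-1 - of_nat r) gchoose k)) =
      (\<Sum>k=0..r. (of_nat r gchoose k) * ((-1 - of_nat r) gchoose k) :: rat)"
    using that by (intro sum.mono_neutral_right) (auto simp flip: binomial_gbinomial)
  also have "\<dots> = (\<Sum>k=0..r. ((-1 - of_nat r) gchoose k) * (of_nat r gchoose (r - k)))"
    by (intro sum.cong refl) (simp add: binomial_symmetric[of _ r, symmetric] flip: binomial_gbinomial)
  also have "\<dots> = (-1) gchoose r"
    using gbinomial_Vandermonde[of "-1 - of_nat r :: rat" "of_nat r" r] by simp
  also have "\<dots> = (-1) ^ r"
    using gbinomial_minus[of "1::rat" r] by (simp flip: binomial_gbinomial)
  finally show ?thesis .
qed

text \<open>Interchanging the sums leaves the hockey-stick sum of \<open>n choose k\<close> over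
  \<open>n\<close>; the induction uses Pascal's rule instead.\<close>

lemma sum_G:
  "(\<Sum>n=0..m. G n x) =
    (\<Sum>k=0..m. of_nat (Suc m choose Suc k) * (-1) ^ k * (x gchoose k) * ((-1 - x) gchoose k))"
proof (induction m)
  case 0
  then show ?case by (simp add: G_def)
next
  case (Suc m)
  let ?a = "\<lambda>k. (-1) ^ k * (x gchoose k) * ((-1 - x) gchoose k)"
  have "(\<Sum>n=0..Suc m. G n x) =
      (\<Sum>k=0..m. of_nat (Suc m choose Suc k) * ?a k) + (\<Sum>k=0..Suc m. of_nat (Suc m choose k) * ?a k)"
    unfolding sum.atLeast0_atMost_Suc[of "\<lambda>n. G n x"] Suc.IH by (simp only: G_def mult.assoc)
  \<comment> \<open>The added term \<open>k = Suc m\<close> has coefficient 0; with equal ranges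
    Pascal's rule applies termwise.\<close>
  also have "(\<Sum>k=0..m. of_nat (Suc m choose Suc k) * ?a k) =
      (\<Sum>k=0..Suc m. of_nat (Suc m choose Suc k) * ?a k)"
    by (simp add: binomial_eq_0 del: binomial_Suc_Suc)
  finally show ?case
    unfolding sum.distrib[symmetric] binomial_Suc_Suc[of "Suc m"]
    by (simp only: of_nat_add distrib_right mult.assoc add.commute)
qed

text \<open>Summation by parts with \<open>x (x + 1) a\<^sub>k / (k + 1) = k a\<^sub>k - (k + 1) a\<^bsub>k + 1\<^esub>\<close>, where
  \<open>a\<^sub>k\<close> is the product of the two binomial coefficients.\<close>

lemma sum_G_by_parts:
  fixes x :: rat
  assumes "m > 0"
  shows "x * (x + 1) * (\<Sum>n=0..m - 1. G n x) = - (of_nat m ^ 2) *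
    (\<Sum>k=0..m - 1. (-1) ^ k * of_nat ((m - 1) choose k) * ((x gchoose Suc k) * ((-1 - x) gchoose Suc k)))"
proof -
  define a where "a k = (x gchoose k) * ((-1 - x) gchoose k)" for k
  define b :: "nat \<Rightarrow> rat" where "b k = (-1) ^ k * of_nat ((m - 1) choose k)" for k
  have a: "x * (x + 1) * a k = (of_nat k + 1) * (of_nat k * a k - (of_nat k + 1) * a (Suc k))" for k
  proof -
    have "(of_nat k + 1) ^ 2 * a (Suc k) = (of_nat k * (of_nat k + 1) - x * (x + 1)) * a k"
      unfolding a_def gchoose_Suc_div
      by (simp add: divide_simps add_eq_0_iff_both_eq_0) (simp add: algebra_simps power2_eq_square)
    then show ?thesis by (simp add: algebra_simps power2_eq_square)
  qed
  \<comment> \<open>Absorption uses up the factor \<open>k + 1\<close> from the previous identity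
    and produces the first of the two factors \<open>m\<close>.\<close>
  have c: "of_nat (m choose Suc k) * (of_nat k + 1) = (of_nat m * of_nat ((m - 1) choose k) :: rat)" for k
  proof -
    have "(m choose Suc k) * Suc k = m * ((m - 1) choose k)"
      using binomial_absorption[of k m] by (simp add: mult.commute)
    then have "(of_nat ((m choose Suc k) * Suc k) :: rat) = of_nat (m * ((m - 1) choose k))" by simp
    then show ?thesis by (simp add: algebra_simps)
  qed
  \<comment> \<open>After an index shift \<open>a (Suc k)\<close> has coefficient
    \<open>(k + 1) * (b (k + 1) - b k)\<close>, which is \<open>- m * b k\<close> by Pascal's rule
    and absorption: the second factor \<open>m\<close>. The last summand is the boundary
    term.\<close>
  have parts: "(\<Sum>k=0..n. b k * (of_nat k * a k - (of_nat k + 1) * a (Suc k))) =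
      - of_nat m * (\<Sum>k=0..n. b k * a (Suc k)) - of_nat (Suc n) * b (Suc n) * a (Suc n)" for n
  proof (induction n)
    case 0
    have b: "b (Suc 0) = 1 - of_nat m" "b 0 = 1" using assms by (simp_all add: b_def)
    show ?case by (simp add: b algebra_simps)
  next
    case (Suc n)
    have "(of_nat n + 2) * b (Suc (Suc n)) = (of_nat n + 2 - of_nat m) * b (Suc n)"
    proof -
      have "(m - 1 choose Suc (Suc n)) * Suc (Suc n) = (m - 1 - Suc n) * (m - 1 choose Suc n)"
        using binomial_absorb_comp[of "m - 1" "Suc n"] binomial_absorption[of "Suc n" "m - 1"]
        by (simp add: mult.commute)
      then have "(of_nat (m - 1 choose Suc (Suc n)) * of_nat (Suc (Suc n)) :: rat) =
          of_nat (m - 1 - Suc n) * of_nat (m - 1 choose Suc n)"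
        by (simp only: of_nat_mult[symmetric])
      also have "\<dots> = (of_nat m - of_nat n - 2) * of_nat (m - 1 choose Suc n)"
        \<comment> \<open>Natural subtraction truncates only when \<open>Suc n > m - 1\<close>, and
          then the binomial coefficient is 0.\<close>
        by (cases "Suc n \<le> m - 1") (auto simp: of_nat_diff)
      finally have "(-1) ^ n * (of_nat (m - 1 choose Suc (Suc n)) * of_nat (Suc (Suc n))) =
          (-1) ^ n * ((of_nat m - of_nat n - 2) * of_nat (m - 1 choose Suc n) :: rat)"
        by (rule arg_cong)
      then show ?thesis by (simp add: b_def algebra_simps del: binomial_Suc_Suc)
    qed
    then have "of_nat (Suc (Suc n)) * b (Suc (Suc n)) * a (Suc (Suc n)) =
       (of_nat n + 2 - of_nat m) * b (Suc n) * a (Suc (Suc n))" by (simp add: add.commute)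
    then show ?case unfolding sum.atLeast0_atMost_Suc Suc.IH by (simp add: algebra_simps)
  qed
  have "x * (x + 1) * (\<Sum>n=0..m - 1. G n x) =
      (\<Sum>k=0..m - 1. of_nat (m choose Suc k) * (-1) ^ k * (x * (x + 1) * a k))"
    using sum_G[of x "m - 1"] assms by (simp add: a_def sum_distrib_left ac_simps)
  also have "\<dots> = (\<Sum>k=0..m - 1. of_nat m * (b k * (of_nat k * a k - (of_nat k + 1) * a (Suc k))))"
  proof (rule sum.cong[OF refl])
    fix k
    define d where "d = of_nat k * a k - (of_nat k + 1) * a (Suc k)"
    have "of_nat (m choose Suc k) * (-1) ^ k * (x * (x + 1) * a k) =
        (of_nat (m choose Suc k) * (of_nat k + 1)) * ((-1) ^ k * d)"
      unfolding a d_def by simp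
    also have "\<dots> = of_nat m * (b k * d)"
      unfolding c b_def by simp
    finally show "of_nat (m choose Suc k) * (-1) ^ k * (x * (x + 1) * a k) =
        of_nat m * (b k * (of_nat k * a k - (of_nat k + 1) * a (Suc k)))"
      unfolding d_def .
  qed
  also have "\<dots> = of_nat m * (- of_nat m * (\<Sum>k=0..m - 1. b k * a (Suc k)) -
      of_nat (Suc (m - 1)) * b (Suc (m - 1)) * a (Suc (m - 1)))"
    unfolding parts[symmetric] by (rule sum_distrib_left[symmetric])
  \<comment> \<open>The boundary term disappears because \<open>m - 1 choose m\<close> is 0.\<close>
  also have "b (Suc (m - 1)) = 0" by (simp add: b_def binomial_eq_0)
  also have "of_nat m * (- of_nat m * (\<Sum>k=0..m - 1. b k * a (Suc k)) -
      of_nat (Suc (m - 1)) * 0 * a (Suc (m - 1)))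
      = - (of_nat m ^ 2) * (\<Sum>k=0..m - 1. b k * a (Suc k))"
    by (simp add: power2_eq_square)
  finally show ?thesis unfolding a_def b_def .
qed

section \<open>The general congruence modulo \<open>p^3\<close>\<close>

text \<open>The bounds on \<open>r\<close> make \<open>x\<close> and \<open>x + 1\<close> units. The
  exact identity can then be divided by \<open>x * (x + 1)\<close>, and its factor
  \<open>p^2\<close> raises a congruence modulo \<open>p\<close> to one modulo
  \<open>p^3\<close>.\<close>

lemma sum_G_cong:
  assumes p: "prime p" "odd p" and t: "t \<in> Zp p" and r: "0 < r" "Suc r < p"
    and x: "x = of_nat r + of_nat p * t"
  shows "zp_cong p 3 (\<Sum>n=0..p-1. G n x)
    (of_nat p ^ 2 * ((t * (t + 1) + 1 - (-1) ^ r) / (x * (x + 1))))"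
proof -
  note [simp] = Zp_of_nat[OF p(1)] Zp_0[OF p(1)] Zp_1[OF p(1)]
  define a where "a k = (x gchoose k) * ((-1 - x) gchoose k)" for k
  define b :: "nat \<Rightarrow> rat" where "b k = (-1) ^ k * of_nat ((p - 1) choose k)" for k
  have p0: "p > 0" using r by simp
  have m1: "-1 \<in> Zp p" using Zp_uminus[OF p(1) Zp_1[OF p(1)]] .
  \<comment> \<open>Since \<open>p - 1\<close> is congruent to -1, the binomial coefficient is
    congruent to \<open>(-1) gchoose k\<close>, that is to \<open>(-1) ^ k\<close>.\<close>
  have b: "zp_cong p 1 (b k) 1" if "k \<le> p - 1" for k
  proof -
    have "zp_cong p 1 (of_nat (p - 1)) (-1)"
      using zp_cong_add_multiple[OF p(1) m1, of 1] p0 by (simp add: of_nat_diff)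
    then have "zp_cong p 1 (of_nat (p - 1) gchoose k) ((-1) gchoose k)"
      using zp_cong_gchoose[OF p(1)] that p0 by simp
    then have "zp_cong p 1 ((-1) ^ k * (of_nat (p - 1) gchoose k)) ((-1) ^ k * ((-1) gchoose k))"
      using Zp_of_int[OF p(1), of "(-1) ^ k"] by (intro zp_cong_cmult[OF p(1)]) simp_all
    moreover have "((-1) ^ k * ((-1) gchoose k)) = (1 :: rat)"
      using gbinomial_minus[of "1::rat" k] by (simp flip: binomial_gbinomial power_mult_distrib mult.assoc)
    ultimately show ?thesis by (simp add: b_def binomial_gbinomial)
  qed
  have xr: "zp_cong p 1 x (of_nat r)"
    unfolding x by (intro zp_cong_add_multiple p t) simp
  have xr': "zp_cong p 1 (-1 - x) (-1 - of_nat r)"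
    by (intro zp_cong_diff p zp_cong_refl xr m1)
  have a: "zp_cong p 1 (a k) ((of_nat r gchoose k) * ((-1 - of_nat r) gchoose k))" if "k < p" for k
    unfolding a_def by (intro zp_cong_mult zp_cong_gchoose p that xr xr')
  have ap: "zp_cong p 1 (a p) (- (t * (t + 1)))"
  proof -
    \<comment> \<open>The reflected argument has residue \<open>p - 1 - r\<close> and quotient
      \<open>-1 - t\<close>, so both factors of \<open>a p\<close> have the form required for lower
      index \<open>p\<close>.\<close>
    have "-1 - x = of_nat (p - 1 - r) + of_nat p * (-1 - t)"
      using r by (simp add: x of_nat_diff algebra_simps)
    moreover have "-1 - t \<in> Zp p" using Zp_diff[OF p(1) m1 t] .
    ultimately have "zp_cong p 1 ((-1 - x) gchoose p) (-1 - t)"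
      using zp_cong_gchoose_prime[OF p, of "p - 1 - r" "-1 - t"] p0 by simp
    moreover have "zp_cong p 1 (x gchoose p) t"
      unfolding x using r by (intro zp_cong_gchoose_prime p t) simp
    ultimately have "zp_cong p 1 (a p) (t * (-1 - t))"
      unfolding a_def by (intro zp_cong_mult p)
    then show ?thesis by (simp add: algebra_simps)
  qed
  have aZp: "a k \<in> Zp p" if "k \<le> p" for k
    using a[of k] ap that unfolding zp_cong_def by (cases "k = p") auto
  have "zp_cong p 1 (\<Sum>k=0..p - 1. b k * a (Suc k)) (\<Sum>k=0..p - 1. 1 * a (Suc k))"
    using p0 by (intro zp_cong_sum zp_cong_mult zp_cong_refl b aZp p) auto
  \<comment> \<open>The shifted sum runs over the indices 1 to \<open>p\<close>: it gains
    \<open>a p\<close> and loses \<open>a 0 = 1\<close>.\<close>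
  moreover have "(\<Sum>k=0..p - 1. 1 * a (Suc k)) = (\<Sum>k=0..p - 1. a k) + a p - 1"
  proof -
    have "(\<Sum>k=0..p - 1. a (Suc k)) + a 0 = (\<Sum>k=0..Suc (p - 1). a k)"
      by (subst sum.atLeast0_atMost_Suc_shift) simp
    also have "\<dots> = (\<Sum>k=0..p - 1. a k) + a p"
      unfolding sum.atLeast0_atMost_Suc using p0 by simp
    finally show ?thesis by (simp add: a_def[of 0])
  qed
  moreover have "zp_cong p 1 ((\<Sum>k=0..p - 1. a k) + a p - 1) ((-1) ^ r + - (t * (t + 1)) - 1)"
  proof -
    have "zp_cong p 1 (\<Sum>k=0..p - 1. a k)
        (\<Sum>k=0..p - 1. (of_nat r gchoose k) * ((-1 - of_nat r) gchoose k))"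
      using p0 by (intro zp_cong_sum a p) auto
    then show ?thesis using r
      by (intro zp_cong_diff zp_cong_add ap p zp_cong_refl) (simp_all add: sum_gchoose_mult_gchoose)
  qed
  ultimately have "zp_cong p 1 (\<Sum>k=0..p - 1. b k * a (Suc k)) ((-1) ^ r + - (t * (t + 1)) - 1)"
    using zp_cong_trans[OF p(1)] by simp
  moreover have "t * (t + 1) + 1 - (-1) ^ r = - ((-1) ^ r + - (t * (t + 1)) - 1)" by simp
  ultimately have T: "zp_cong p 1 (- (\<Sum>k=0..p - 1. b k * a (Suc k))) (t * (t + 1) + 1 - (-1) ^ r)"
    using zp_cong_uminus[OF p(1)] by metis
  \<comment> \<open>Both \<open>i = 0\<close> and \<open>i = 1\<close> are needed:
    \<open>x + i\<close> is congruent to \<open>r + i\<close>, which lies strictly between 0 and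
    \<open>p\<close>.\<close>
  have unit: "x + of_nat i \<noteq> 0 \<and> inverse (x + of_nat i) \<in> Zp p" if "i \<le> 1" for i
  proof -
    have cong: "zp_cong p 1 (of_nat (r + i)) (x + of_nat i)"
    proof -
      have "x + of_nat i \<in> Zp p" using xr Zp_add[OF p(1)] by (simp add: zp_cong_def)
      from zp_cong_add_multiple[OF p(1) this Zp_uminus[OF p(1) t]]
      show ?thesis by (simp add: x add.commute)
    qed
    have "\<not> zp_cong p 1 (x + of_nat i) 0"
    proof
      assume "zp_cong p 1 (x + of_nat i) 0"
      then have "p dvd r + i" using zp_cong_trans[OF p(1) cong] zp_cong_of_nat_imp_dvd[OF p(1)] by blast
      then show False using r that by (auto dest: dvd_imp_le)
    qed
    then show ?thesis
      using Zp_inverse[OF p(1)] cong zp_cong_refl[OF p(1) Zp_0[OF p(1)]] unfolding zp_cong_def by metis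
  qed
  have u: "x * (x + 1) \<noteq> 0" "inverse (x * (x + 1)) \<in> Zp p"
    using unit[of 0] unit[of 1] Zp_mult[OF p(1)] by auto
  have "(\<Sum>n=0..p-1. G n x) =
      of_nat p ^ 2 * (inverse (x * (x + 1)) * (- (\<Sum>k=0..p - 1. b k * a (Suc k))))"
    using sum_G_by_parts[OF p0, of x] u(1) unfolding a_def[symmetric] b_def[symmetric]
    by (simp add: field_simps)
  then show ?thesis
    using zp_cong_power_mult[OF p(1) zp_cong_cmult[OF p(1) u(2) T], of 2]
    by (simp add: divide_inverse mult.commute)
qed

section \<open>The special values \<open>x = - 1 / m\<close> for \<open>m = 3, 4, 6\<close>\<close>

text \<open>Dividing \<open>m * r + 1 = j * p\<close> by \<open>m\<close> exhibits
  \<open>- 1 / m\<close> as \<open>r + p t\<close> with \<open>t = - j / m\<close>. Modulo 3, 4 and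
  6 the only units are 1 and -1, so \<open>j = 1\<close> and \<open>j = m - 1\<close> cover all
  primes needed, and \<open>s\<close> depends only on \<open>m\<close> and the parity of
  \<open>r\<close>.\<close>

lemma sum_G_cong_fraction:
  fixes p j m r :: nat
  assumes p: "prime p" "odd p" and pm: "\<not> p dvd m" and r: "0 < r" "Suc r < p"
    and eq: "m * r + 1 = j * p"
    and s: "s = (if even r then 1 else 1 - 2 * of_nat m ^ 2 / (of_nat m - 1))"
    and j: "j = 1 \<or> Suc j = m"
  shows "zp_cong p 3 (\<Sum>n=0..p-1. G n (- 1 / of_nat m)) (s * of_nat p ^ 2)"
proof -
  have m: "m \<noteq> 0" "m \<noteq> 1" using pm eq r j by auto
  have "of_nat (m * r + 1) = (of_nat (j * p) :: rat)" using eq by simp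
  then have x: "- 1 / of_nat m = of_nat r + of_nat p * (- (of_nat j / of_nat m) :: rat)"
    using m by (simp add: field_simps)
  have t: "- (of_nat j / of_nat m) \<in> Zp p"
    using Zp_uminus[OF p(1) Zp_mult[OF p(1) Zp_of_nat[OF p(1)] Zp_inverse_of_nat[OF p(1) pm]]]
    by (simp add: divide_inverse)
  define u :: rat where "u = (- 1 / of_nat m) * (- 1 / of_nat m + 1)"
  have m': "(of_nat m :: rat) \<noteq> 0" "(of_nat m :: rat) - 1 \<noteq> 0" using m by auto
  then have u: "u \<noteq> 0" "1 / u = - (of_nat m ^ 2 / (of_nat m - 1))"
    unfolding u_def by (simp_all add: field_simps power2_eq_square)
  \<comment> \<open>The quotient \<open>t\<close> equals \<open>x\<close> for \<open>j = 1\<close>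
    and \<open>-1 - x\<close> for \<open>j = m - 1\<close>; the product \<open>t * (t + 1)\<close>
    is the same for both.\<close>
  have "of_nat j = (1 :: rat) \<or> of_nat j = of_nat m - (1 :: rat)" using j by auto
  then have "(- (of_nat j / of_nat m)) * (- (of_nat j / of_nat m) + 1) = u"
  proof
    assume j: "of_nat j = (1 :: rat)"
    show ?thesis unfolding j u_def by simp
  next
    assume j: "of_nat j = of_nat m - (1 :: rat)"
    show ?thesis unfolding j u_def using m' by (simp add: field_simps)
  qed
  moreover have "(u + 1 - (-1) ^ r) / u = s"
    unfolding s using u by (auto simp: add_divide_distrib diff_divide_distrib)
  ultimately have "((- (of_nat j / of_nat m)) * (- (of_nat j / of_nat m) + 1) + 1 - (-1) ^ r) /
      ((- 1 / of_nat m) * (- 1 / of_nat m + 1)) = s"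
    unfolding u_def[symmetric] by simp
  then show ?thesis
    using sum_G_cong[OF p t r x] by (simp add: mult.commute)
qed

text \<open>For \<open>p = 5\<close> the residue of \<open>- 1 / 6\<close> is \<open>p - 1\<close>, which the general congruence excludes.\<close>

lemma sum_G_sixth_5: "zp_cong 5 3 (\<Sum>n=0..4. G n (- 1 / 6)) (5 ^ 2)"
proof -
  have "prime (5 :: nat)" by simp
  have S: "(\<Sum>n=0..4. G n (- 1 / 6)) = 4004241025 / 967458816"
    unfolding sum_G by (simp add: numeral_eq_Suc gchoose_Suc_div)
  have "(of_int a / of_int 967458816 :: rat) \<in> Zp 5" for a
    unfolding Zp_iff[OF \<open>prime 5\<close>] by (intro exI[of _ a] exI[of _ 967458816]) simp
  from this[of 4004241025] this[of "-161457835"]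
  have "4004241025 / 967458816 \<in> Zp 5" "-161457835 / 967458816 \<in> Zp 5" by simp_all
  moreover have "5 ^ 2 \<in> Zp 5" using Zp_of_nat[OF \<open>prime 5\<close>, of 25] by simp
  \<comment> \<open>The witness is \<open>(4004241025 / 967458816 - 25) / 125\<close>; its
    denominator is \<open>2^14 * 3^10\<close>, prime to 5.\<close>
  ultimately show ?thesis
    unfolding zp_cong_def S by (intro conjI bexI[of _ "-161457835 / 967458816"]) simp_all
qed

lemma sum_G3_cong:
  assumes p: "prime p" "p > 3"
  shows "[p = 1] (mod 3) \<Longrightarrow> zp_cong p 3 (\<Sum>n=0..p-1. G3 n / 27 ^ n) (of_nat p ^ 2)"
    and "[p = 2] (mod 3) \<Longrightarrow> zp_cong p 3 (\<Sum>n=0..p-1. G3 n / 27 ^ n) (- 8 * of_nat p ^ 2)"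
proof -
  have odd: "odd p" using p prime_odd_nat by auto
  have pm: "\<not> p dvd 3" using p by (auto dest: dvd_imp_le)
  note main = sum_G_cong_fraction[OF p(1) odd pm]
  define q where "q = p div 3"
  show "zp_cong p 3 (\<Sum>n=0..p-1. G3 n / 27 ^ n) (of_nat p ^ 2)" if "[p = 1] (mod 3)"
  proof -
    \<comment> \<open>Here \<open>j = 1\<close> and \<open>r = q\<close>, which is even because
      \<open>p\<close> is odd.\<close>
    have q: "p = 3 * q + 1" using that by (simp add: q_def cong_def) presburger
    show ?thesis using main[of q 1 1] p q odd by (auto simp: G3_def)
  qed
  show "zp_cong p 3 (\<Sum>n=0..p-1. G3 n / 27 ^ n) (- 8 * of_nat p ^ 2)" if "[p = 2] (mod 3)"
  proof -
    \<comment> \<open>Here \<open>j = 2\<close> and \<open>r = 2 * q + 1\<close> is always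
      odd.\<close>
    have q: "p = 3 * q + 2" using that by (simp add: q_def cong_def) presburger
    show ?thesis using main[of "2 * q + 1" 2 "- 8"] p q odd by (auto simp: G3_def)
  qed
qed

text \<open>The class of \<open>p\<close> modulo 4 fixes \<open>j\<close> as 1 or 3; then
  \<open>4 * r + 1 = j * p\<close> makes the parity of \<open>r\<close> depend on \<open>p\<close>
  modulo 8.\<close>

lemma sum_G4_cong:
  assumes p: "prime p" "p > 3"
  shows "[p = 1] (mod 8) \<or> [p = 3] (mod 8) \<Longrightarrow>
      zp_cong p 3 (\<Sum>n=0..p-1. G4 n / 64 ^ n) (of_nat p ^ 2)"
    and "[p = 5] (mod 8) \<or> [p = 7] (mod 8) \<Longrightarrow>
      zp_cong p 3 (\<Sum>n=0..p-1. G4 n / 64 ^ n) (- (29 / 3) * of_nat p ^ 2)"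
proof -
  have odd: "odd p" using p prime_odd_nat by auto
  have "\<not> p dvd 2" using p by (auto dest: dvd_imp_le)
  then have pm: "\<not> p dvd 4" using prime_dvd_mult_iff[OF p(1), of 2 2] by simp
  note main = sum_G_cong_fraction[OF p(1) odd pm]
  define q where "q = p div 8"
  show "zp_cong p 3 (\<Sum>n=0..p-1. G4 n / 64 ^ n) (of_nat p ^ 2)"
    if "[p = 1] (mod 8) \<or> [p = 3] (mod 8)"
  proof -
    have "p = 8 * q + 1 \<or> p = 8 * q + 3"
      using that by (simp add: q_def cong_def) presburger
    then show ?thesis
      using main[of "2 * q" 1 1] main[of "6 * q + 2" 3 1] p by (elim disjE) (auto simp: G4_def)
  qed
  show "zp_cong p 3 (\<Sum>n=0..p-1. G4 n / 64 ^ n) (- (29 / 3) * of_nat p ^ 2)"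
    if "[p = 5] (mod 8) \<or> [p = 7] (mod 8)"
  proof -
    have "p = 8 * q + 5 \<or> p = 8 * q + 7"
      using that by (simp add: q_def cong_def) presburger
    then show ?thesis
      using main[of "2 * q + 1" 1 "- (29 / 3)"] main[of "6 * q + 5" 3 "- (29 / 3)"] p
      by (elim disjE) (auto simp: G4_def)
  qed
qed

text \<open>The class of \<open>p\<close> modulo 6 fixes \<open>j\<close> as 1 or 5. Both are 1
  modulo 4, so \<open>6 * r + 1 = j * p\<close> makes \<open>r\<close> even exactly when
  \<open>p\<close> is 1 modulo 4. Explicit formulas for \<open>r\<close> need \<open>p\<close>
  modulo 12.\<close>

lemma sum_G6_cong:
  assumes p: "prime p" "p > 3"
  shows "[p = 1] (mod 4) \<Longrightarrow> zp_cong p 3 (\<Sum>n=0..p-1. G6 n / 432 ^ n) (of_nat p ^ 2)"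
    and "[p = 3] (mod 4) \<Longrightarrow> zp_cong p 3 (\<Sum>n=0..p-1. G6 n / 432 ^ n) (- (67 / 5) * of_nat p ^ 2)"
proof -
  have odd: "odd p" using p prime_odd_nat by auto
  have "\<not> 3 dvd p" using p primes_dvd_imp_eq[of 3 p] by auto
  then have mod3: "p mod 3 \<noteq> 0" by presburger
  have "\<not> p dvd 2" "\<not> p dvd 3" using p by (auto dest: dvd_imp_le)
  then have pm: "\<not> p dvd 6" using prime_dvd_mult_iff[OF p(1), of 2 3] by simp
  note main = sum_G_cong_fraction[OF p(1) odd pm]
  define q c where "q = p div 12" and "c = p mod 12"
  have qc: "p = 12 * q + c" unfolding q_def c_def by simp
  have "c \<in> {..<12}" unfolding c_def by simp
  also have "{..<12} = {0, 1, 2, 3, 4, 5, 6, 7, 8, 9, 10, 11 :: nat}" by (simp add: lessThan_nat_numeral lessThan_Suc insert_commute)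
  finally have "c \<in> {0, 1, 2, 3, 4, 5, 6, 7, 8, 9, 10, 11}" .
  moreover have "c mod 4 = p mod 4" "c mod 3 = p mod 3"
    unfolding c_def by (simp_all add: mod_mod_cancel)
  ultimately have c: "p mod 4 = 1 \<Longrightarrow> c = 1 \<or> c = 5" "p mod 4 = 3 \<Longrightarrow> c = 7 \<or> c = 11"
    using mod3 by auto
  show "zp_cong p 3 (\<Sum>n=0..p-1. G6 n / 432 ^ n) (of_nat p ^ 2)" if "[p = 1] (mod 4)"
  proof -
    have "p = 12 * q + 1 \<or> p = 12 * q + 5"
      using that c(1) qc by (auto simp: cong_def)
    \<comment> \<open>In the class of 5 modulo 12, \<open>r = 10 * q + 4\<close> satisfies
      \<open>Suc r < p\<close> only for \<open>q > 0\<close>.\<close>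
    then consider "p = 5" | "p = 12 * q + 1" | "p = 12 * q + 5" "p \<noteq> 5" by blast
    then show ?thesis
      using main[of "2 * q" 1 1] main[of "10 * q + 4" 5 1] p sum_G_sixth_5
      by cases (auto simp: G6_def)
  qed
  show "zp_cong p 3 (\<Sum>n=0..p-1. G6 n / 432 ^ n) (- (67 / 5) * of_nat p ^ 2)" if "[p = 3] (mod 4)"
  proof -
    have "p = 12 * q + 7 \<or> p = 12 * q + 11"
      using that c(2) qc by (auto simp: cong_def)
    then show ?thesis
      using main[of "2 * q + 1" 1 "- (67 / 5)"] main[of "10 * q + 9" 5 "- (67 / 5)"] p
      by (elim disjE) (auto simp: G6_def)
  qed
qed

section \<open>The general congruence in terms of \<open>zp_residue\<close>\<close>

text \<open>Existence and uniqueness of the residue give the defining properties of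
  \<open>zp_residue\<close>; the two excluded classes become the bounds \<open>0 < r\<close> and
  \<open>Suc r < p\<close>, and \<open>x'\<close> is the quotient \<open>t\<close>.\<close>

lemma sum_G_cong_residue:
  assumes p: "prime p" "odd p" and x: "x \<in> Zp p" "\<not> zp_cong p 1 x 0" "\<not> zp_cong p 1 x (-1)"
    and x': "x' = (x - of_nat (zp_residue p x)) / of_nat p"
  shows "zp_cong p 3 (\<Sum>n=0..p-1. G n x)
    (of_nat p ^ 2 * ((x' * (x' + 1) + 1 - (-1) ^ zp_residue p x) / (x * (x + 1))))"
proof -
  define r where "r = zp_residue p x"
  have p0: "p > 0" using p(1) prime_gt_0_nat by blast
  have r: "r < p" "zp_cong p 1 x (of_nat r)"
    using theI'[OF zp_residue_unique[OF p(1) x(1)]] unfolding r_def zp_residue_def by auto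
  then obtain t where t: "t \<in> Zp p" "x - of_nat r = of_nat p * t"
    unfolding zp_cong_def by auto
  then have "x' = t" using p0 unfolding x' r_def by simp
  then have t: "x' \<in> Zp p" "x = of_nat r + of_nat p * x'"
    using t by (simp_all add: algebra_simps)
  have "r \<noteq> 0" using r x by (metis of_nat_0)
  moreover have "Suc r \<noteq> p"
  proof
    assume "Suc r = p"
    then have "of_nat r = -1 + of_nat p * (1 :: rat)" by auto
    then have "zp_cong p 1 (of_nat r) (-1)"
      using zp_cong_add_multiple[OF p(1) Zp_of_int[OF p(1), of "-1"] Zp_1[OF p(1)]] by simp
    then show False using zp_cong_trans[OF p(1) r(2)] x by blast
  qed
  ultimately show ?thesis
    using sum_G_cong[OF p t(1) _ _ t(2)] r(1) unfolding r_def by simp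
qed

theorem theorem3p2:
  shows "(\<forall>(p::nat) (x::rat).
      prime p \<longrightarrow> odd p \<longrightarrow> x \<in> Zp p \<longrightarrow> \<not> zp_cong p 1 x 0 \<longrightarrow> \<not> zp_cong p 1 x (-1) \<longrightarrow>
      (let x' = (x - of_nat (zp_residue p x)) / of_nat p
       in zp_cong p 3 (\<Sum>n=0..p-1. G n x)
            (of_nat p ^ 2 * ((x' * (x' + 1) + 1 - (-1) ^ zp_residue p x) / (x * (x + 1))))))
    \<and> (\<forall>p::nat. prime p \<longrightarrow> p > 3 \<longrightarrow>
        ([p = 1] (mod 3) \<longrightarrow> zp_cong p 3 (\<Sum>n=0..p-1. G3 n / 27 ^ n) (of_nat p ^ 2))
      \<and> ([p = 2] (mod 3) \<longrightarrow> zp_cong p 3 (\<Sum>n=0..p-1. G3 n / 27 ^ n) (- 8 * of_nat p ^ 2))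
      \<and> ([p = 1] (mod 8) \<or> [p = 3] (mod 8) \<longrightarrow>
          zp_cong p 3 (\<Sum>n=0..p-1. G4 n / 64 ^ n) (of_nat p ^ 2))
      \<and> ([p = 5] (mod 8) \<or> [p = 7] (mod 8) \<longrightarrow>
          zp_cong p 3 (\<Sum>n=0..p-1. G4 n / 64 ^ n) (- (29 / 3) * of_nat p ^ 2))
      \<and> ([p = 1] (mod 4) \<longrightarrow> zp_cong p 3 (\<Sum>n=0..p-1. G6 n / 432 ^ n) (of_nat p ^ 2))
      \<and> ([p = 3] (mod 4) \<longrightarrow>
          zp_cong p 3 (\<Sum>n=0..p-1. G6 n / 432 ^ n) (- (67 / 5) * of_nat p ^ 2)))"
proof (intro conjI allI impI)
  fix p :: nat and x :: rat
  assume "prime p" "odd p" "x \<in> Zp p" "\<not> zp_cong p 1 x 0" "\<not> zp_cong p 1 x (-1)"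
  from sum_G_cong_residue[OF this refl]
  show "let x' = (x - of_nat (zp_residue p x)) / of_nat p
    in zp_cong p 3 (\<Sum>n=0..p-1. G n x)
      (of_nat p ^ 2 * ((x' * (x' + 1) + 1 - (-1) ^ zp_residue p x) / (x * (x + 1))))"
    unfolding Let_def .
qed (fact sum_G3_cong sum_G4_cong sum_G6_cong)+

end
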